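(* Let $D\subseteq\mathbb{R}$ be a nonempty compact set, let $a>0$, $0\le b_{\min}<b_{\max}$, $k_1,k_2\in\mathbb{R}$ be constants, and let $f:D\times[0,a]\to\mathbb{R}$ be continuous with $0\le f(d,x)\le x$ for all $(d,x)\in D\times[0,a]$. Let $(x^*,u^*,v^* )\in(0,a)\times(b_{\min},b_{\max})\times[0,+\infty)$ satisfy $f(d,x^* )=u^*+v^*<a-x^*$ for all $d\in D$, and suppose that $x^*+v^*+b_{\max}<a$. Suppose that there exist constants $M>0$, $\lambda\in(0,1)$, $\gamma\ge0$, $q\in(0,1]$, $r\in\mathbb{R}$ such that for all sequences $\{d(i)\in D\}_{i=0}^\infty$, $\{v(i)\in[0,+\infty)\}_{i=0}^\infty$ and every initial condition $(x(0),y(0),w(0))\in[0,a]^2\times\mathbb{R}$, the corresponding solution of the closed-loop system (defined in the context) satisfies, for all $t\ge1$, $$\max\big(q(x^*-x(t)),\,x(t)-x^*\big)\le \lambda^tM(1+|r|+|k_1|+|k_2|)\big(|x(0)-x^*|+|y(0)-x^*|+|w(0)-u^*|\big)+\frac{\gamma}{1-\lambda}\max_{i=0,\ldots,t-1}|v(i)-v^*|.$$ Then $k_2>0$, and for every $d\in D$ the following two properties hold: (i) either the equation $f(d,y)=\min(b_{\max}+v^*,a-y)$ has no solution $y\in[0,a]$, or all its solutions $y\in[0,a]$ lie in $(x^*,a]$; (ii) all solutions $y\in[0,a]$ of the equation $f(d,y)=\min(b_{\min}+v^*,a-y)$ lie in $[0,x^* )$.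
   Context: The closed-loop system is the discrete-time system on the state space $[0,a]^2\times\mathbb{R}$ with inputs $d(t)\in D$, $v(t)\in[0,+\infty)$ given for $t=0,1,2,\ldots$ by $$x(t+1)=x(t)-f(d(t),x(t))+\min\big(u(t)+v(t),\,a-x(t)\big),\quad y(t+1)=x(t),\quad w(t+1)=u(t),$$ $$u(t)=\max\big(b_{\min},\min(w(t)-k_1(x(t)-y(t))-k_2(x(t)-x^* ),\,b_{\max})\big).$$ *)

theory Defs
  imports "HOL-Analysis.Analysis"
begin

definition feedback ::
  "real \<Rightarrow> real \<Rightarrow> real \<Rightarrow> real \<Rightarrow> real \<Rightarrow> real \<Rightarrow> real \<Rightarrow> real \<Rightarrow> real" where
  "feedback b_min b_max k1 k2 xs x y w =
     max b_min (min (w - k1 * (x - y) - k2 * (x - xs)) b_max)"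

(* The arguments d, v are the inputs and x, y, w the components of the state; xs is the set
   point.  Only the recursion is recorded here: that the inputs take values in D and in [0,\<infinity>)
   and that the initial state lies in [0,a]^2 x R is to be assumed separately.  The state then
   remains in [0,a]^2 x R whenever 0 \<le> f d x \<le> x on D x [0,a] and b_min \<ge> 0. *)
definition closed_loop_solution ::
  "real \<Rightarrow> real \<Rightarrow> real \<Rightarrow> real \<Rightarrow> real \<Rightarrow> real \<Rightarrow> (real \<Rightarrow> real \<Rightarrow> real) \<Rightarrow>
   (nat \<Rightarrow> real) \<Rightarrow> (nat \<Rightarrow> real) \<Rightarrow> (nat \<Rightarrow> real) \<Rightarrow> (nat \<Rightarrow> real) \<Rightarrow> (nat \<Rightarrow> real) \<Rightarrow> bool" where
  "closed_loop_solution a b_min b_max k1 k2 xs f d v x y w \<longleftrightarrow>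
     (\<forall>t. let u = feedback b_min b_max k1 k2 xs (x t) (y t) (w t) in
        x (Suc t) = x t - f (d t) (x t) + min (u + v t) (a - x t) \<and>
        y (Suc t) = x t \<and>
        w (Suc t) = u)"

end

theory Submission
  imports Defs
begin

text \<open>
  For \<open>v = v\<^sup>*\<close> the disturbance term of the estimate vanishes, so every equilibrium of the
  closed loop must have \<open>x = x\<^sup>*\<close>.  The integral action saturates consistently at a state
  \<open>x = y\<close>: the value \<open>w = b\<^sub>m\<^sub>a\<^sub>x\<close> is kept if \<open>k\<^sub>2 (x - x\<^sup>*) \<le> 0\<close>, and \<open>w = b\<^sub>m\<^sub>i\<^sub>n\<close> if
  \<open>k\<^sub>2 (x - x\<^sup>*) \<ge> 0\<close>.  By the intermediate value theorem, \<open>f(d,y) = min(b\<^sub>m\<^sub>a\<^sub>x + v\<^sup>*, a - y)\<close> has a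
  solution \<open>y > x\<^sup>*\<close>, which would be an equilibrium if \<open>k\<^sub>2 \<le> 0\<close>.  For \<open>k\<^sub>2 > 0\<close> the solutions
  excluded by (i) and (ii) would be saturated equilibria.
\<close>

lemma nonpos_of_le_geometric:
  fixes c C lam :: real
  assumes "0 < lam" "lam < 1" and le: "\<And>t. t \<ge> 1 \<Longrightarrow> c \<le> lam ^ t * C"
  shows "c \<le> 0"
proof (rule LIMSEQ_le_const)
  show "(\<lambda>t. lam ^ t * C) \<longlonglongrightarrow> 0"
    using assms(1,2) by (intro tendsto_mult_left_zero LIMSEQ_realpow_zero) auto
  show "\<exists>N. \<forall>n\<ge>N. c \<le> lam ^ n * C"
    using le by blast
qed

lemma feedback_upper_saturated:
  assumes "b_min \<le> b_max" "k2 * (x - xs) \<le> 0"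
  shows "feedback b_min b_max k1 k2 xs x x b_max = b_max"
  using assms by (simp add: feedback_def)

lemma feedback_lower_saturated:
  assumes "b_min \<le> b_max" "k2 * (x - xs) \<ge> 0"
  shows "feedback b_min b_max k1 k2 xs x x b_min = b_min"
  using assms by (simp add: feedback_def)

text \<open>The first premise keeps the \<open>w\<close> component fixed; the second makes the
  inflow equal the outflow \<open>f d x\<close>, so \<open>x\<close> does not move.\<close>

lemma closed_loop_solution_const:
  assumes "feedback b_min b_max k1 k2 xs x x u = u" "f d x = min (u + v) (a - x)"
  shows "closed_loop_solution a b_min b_max k1 k2 xs f
           (\<lambda>_. d) (\<lambda>_. v) (\<lambda>_. x) (\<lambda>_. x) (\<lambda>_. u)"
  using assms by (simp add: closed_loop_solution_def)

theorem theorem3p5: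
  fixes D :: "real set" and f :: "real \<Rightarrow> real \<Rightarrow> real"
    and a b_min b_max k1 k2 xs us vs :: real
  assumes "D \<noteq> {}" and "compact D"
    and "a > 0" and "0 \<le> b_min" and "b_min < b_max"
    and "continuous_on (D \<times> {0..a}) (\<lambda>(d, x). f d x)"
    and "\<forall>d\<in>D. \<forall>x\<in>{0..a}. 0 \<le> f d x \<and> f d x \<le> x"
    and "xs \<in> {0<..<a}" and "us \<in> {b_min<..<b_max}" and "vs \<ge> 0"
    and "\<forall>d\<in>D. f d xs = us + vs \<and> us + vs < a - xs"
    and "xs + vs + b_max < a"
    and "\<exists>M lam \<gamma> q r :: real.
      M > 0 \<and> lam \<in> {0<..<1} \<and> \<gamma> \<ge> 0 \<and> q \<in> {0<..1} \<and>
      (\<forall>(d :: nat \<Rightarrow> real) (v :: nat \<Rightarrow> real) (x :: nat \<Rightarrow> real) (y :: nat \<Rightarrow> real) (w :: nat \<Rightarrow> real).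
         (\<forall>i. d i \<in> D) \<and> (\<forall>i. v i \<ge> 0) \<and> x 0 \<in> {0..a} \<and> y 0 \<in> {0..a} \<and>
         closed_loop_solution a b_min b_max k1 k2 xs f d v x y w \<longrightarrow>
         (\<forall>t\<ge>1. max (q * (xs - x t)) (x t - xs)
            \<le> lam ^ t * M * (1 + \<bar>r\<bar> + \<bar>k1\<bar> + \<bar>k2\<bar>)
                 * (\<bar>x 0 - xs\<bar> + \<bar>y 0 - xs\<bar> + \<bar>w 0 - us\<bar>)
               + \<gamma> / (1 - lam) * (MAX i\<in>{0..t - 1}. \<bar>v i - vs\<bar>)))"
  shows "k2 > 0 \<and>
    (\<forall>d\<in>D.
       ((\<not> (\<exists>y\<in>{0..a}. f d y = min (b_max + vs) (a - y))) \<or>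
        (\<forall>y\<in>{0..a}. f d y = min (b_max + vs) (a - y) \<longrightarrow> y \<in> {xs<..a})) \<and>
       (\<forall>y\<in>{0..a}. f d y = min (b_min + vs) (a - y) \<longrightarrow> y \<in> {0..<xs}))"
proof -
  obtain M lam \<gamma> q r :: real where lam: "0 < lam" "lam < 1" and q: "0 < q"
    and est: "\<forall>d v x y w. (\<forall>i::nat. d i \<in> D) \<and> (\<forall>i::nat. v i \<ge> 0) \<and> x 0 \<in> {0..a} \<and> y 0 \<in> {0..a} \<and>
         closed_loop_solution a b_min b_max k1 k2 xs f d v x y w \<longrightarrow>
         (\<forall>t\<ge>1. max (q * (xs - x t)) (x t - xs)
            \<le> lam ^ t * M * (1 + \<bar>r\<bar> + \<bar>k1\<bar> + \<bar>k2\<bar>)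
                 * (\<bar>x 0 - xs\<bar> + \<bar>y 0 - xs\<bar> + \<bar>w 0 - us\<bar>)
               + \<gamma> / (1 - lam) * (MAX i\<in>{0..t - 1}. \<bar>v i - vs\<bar>))"
    using assms(13) unfolding greaterThanLessThan_iff greaterThanAtMost_iff by (elim exE conjE)
  have equilibrium: "z = xs"
    if d: "d \<in> D" and z: "z \<in> {0..a}" and u: "feedback b_min b_max k1 k2 xs z z u = u"
      and eq: "f d z = min (u + vs) (a - z)" for d z u
  proof -
    define C where "C = M * (1 + \<bar>r\<bar> + \<bar>k1\<bar> + \<bar>k2\<bar>) * (\<bar>z - xs\<bar> + \<bar>z - xs\<bar> + \<bar>u - us\<bar>)"
    \<comment> \<open>Along the constant trajectory every \<open>v i - vs\<close> is 0, so the
      \<open>MAX\<close> over the nonempty range vanishes and only the geometric term remains, with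
      \<open>C\<close> independent of \<open>t\<close>.\<close>
    have "max (q * (xs - z)) (z - xs) \<le> lam ^ t * C" if "t \<ge> 1" for t :: nat
      using est[rule_format, of "\<lambda>_. d" "\<lambda>_. vs" "\<lambda>_. z" "\<lambda>_. z" "\<lambda>_. u" t] d z \<open>vs \<ge> 0\<close> that
        closed_loop_solution_const[where f = f and d = d, OF u eq] by (simp add: C_def mult.assoc)
    then have "max (q * (xs - z)) (z - xs) \<le> 0"
      using nonpos_of_le_geometric[OF lam] by blast
    \<comment> \<open>As \<open>q > 0\<close>, the first entry of the maximum gives
      \<open>xs \<le> z\<close>; the second gives \<open>z \<le> xs\<close>.\<close>
    with q show ?thesis
      by (simp add: mult_le_0_iff)
  qed
  have xs: "0 < xs" "xs < a" and us: "b_min < us" "us < b_max"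
    using assms(8,9) by auto
  have fxs: "f d xs = us + vs" "us + vs < a - xs" if "d \<in> D" for d
    using assms(11) that by auto
  have "k2 > 0"
  proof (rule ccontr)
    assume "\<not> k2 > 0"
    obtain d where d: "d \<in> D"
      using \<open>D \<noteq> {}\<close> by blast
    have "continuous_on {xs..a} (\<lambda>z. (\<lambda>(d, x). f d x) (d, z))"
      using d xs by (intro continuous_on_compose2[OF assms(6)] continuous_intros) auto
    then have cont: "continuous_on {xs..a} (\<lambda>z. f d z - min (b_max + vs) (a - z))"
      by (intro continuous_intros) simp
    \<comment> \<open>At \<open>xs\<close> the outflow \<open>us + vs\<close> lies below both
      arguments of the \<open>min\<close>; at \<open>a\<close> the \<open>min\<close> is at most
      \<open>a - a = 0\<close>.\<close>
    have "f d xs - min (b_max + vs) (a - xs) \<le> 0"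
      using fxs[OF d] us assms(12) by simp
    moreover have "0 \<le> f d a - min (b_max + vs) (a - a)"
      using assms(7) d xs by (simp add: min.coboundedI2)
    ultimately obtain z where z: "xs \<le> z" "z \<le> a" "f d z - min (b_max + vs) (a - z) = 0"
      using IVT'[OF _ _ _ cont] xs by (metis less_imp_le)
    have "k2 * (z - xs) \<le> 0"
      using \<open>\<not> k2 > 0\<close> z by (simp add: mult_nonpos_nonneg)
    then have "z = xs"
      using equilibrium[OF d _ feedback_upper_saturated] z xs assms(5) by simp
    \<comment> \<open>At \<open>xs\<close> the \<open>min\<close> equals \<open>b_max + vs\<close>,
      so the equation would force \<open>us = b_max\<close>.\<close>
    then show False
      using z fxs[OF d] us assms(12) by simp
  qed
  moreover have "y \<in> {xs<..a}"
    if d: "d \<in> D" and y: "y \<in> {0..a}" and eq: "f d y = min (b_max + vs) (a - y)" for d y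
  proof (rule ccontr)
    assume "y \<notin> {xs<..a}"
    then have "y \<le> xs"
      using y by auto
    then have "k2 * (y - xs) \<le> 0"
      using \<open>k2 > 0\<close> by (simp add: mult_nonneg_nonpos)
    \<comment> \<open>Saturation is consistent at \<open>y = xs\<close> too, so this case remains
      and is refuted by \<open>us < b_max\<close>.\<close>
    then have "y = xs"
      using equilibrium[OF d y feedback_upper_saturated eq] assms(5) by simp
    then show False
      using eq fxs[OF d] us assms(12) by simp
  qed
  moreover have "y \<in> {0..<xs}"
    if d: "d \<in> D" and y: "y \<in> {0..a}" and eq: "f d y = min (b_min + vs) (a - y)" for d y
  proof (rule ccontr)
    assume "y \<notin> {0..<xs}"
    then have "xs \<le> y"
      using y by auto
    then have "k2 * (y - xs) \<ge> 0"
      using \<open>k2 > 0\<close> by simp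
    then have "y = xs"
      using equilibrium[OF d y feedback_lower_saturated eq] assms(5) by simp
    \<comment> \<open>The \<open>min\<close> is at most \<open>b_min + vs\<close>, so the equation
      at \<open>xs\<close> would force \<open>us \<le> b_min\<close>.\<close>
    then show False
      using eq fxs[OF d] us by simp
  qed
  ultimately show ?thesis
    by blast
qed

end
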